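(* Let $f$ be the symbol of a tridiagonal $k$-Toeplitz operator. Then $$\Gamma=\bigcup_{\alpha\in[-\pi,\pi]}\sigma\big(f(re^{\mathrm{i}\alpha})\big),\qquad r=\sqrt{\prod_{i=1}^k\left|\frac{b_i}{c_i}\right|}.$$
   Context: Let $k\ge1$, $a_1,\dots,a_k\in\mathbb{C}$ and $b_1,\dots,b_k,c_1,\dots,c_k\in\mathbb{C}\setminus\{0\}$, extended $k$-periodically in the index. The tridiagonal $k$-Toeplitz operator with these parameters is the semi-infinite matrix with entries $a_n$ at $(n,n)$, $b_n$ at $(n,n+1)$, $c_n$ at $(n+1,n)$, $n\ge1$, and zero elsewhere. Its symbol is $f(z)=\mathbf{A}_{-1}z^{-1}+\mathbf{A}_0+\mathbf{A}_1z\in\mathbb{C}^{k\times k}$, $z\in\mathbb{C}\setminus\{0\}$, where $\mathbf{A}_0$ is the leading $k\times k$ block, $\mathbf{A}_{-1}$ has the single nonzero entry $b_k$ in position $(k,1)$, and $\mathbf{A}_1$ has the single nonzero entry $c_k$ in position $(1,k)$. For $\lambda\in\mathbb{C}$ let $z_1(\lambda),z_2(\lambda)$ be the two roots of the quadratic polynomial $z\det(f(z)-\lambda\,\mathrm{Id})$ in $z$, and $\Gamma=\{\lambda\in\mathbb{C}:|z_1(\lambda)|=|z_2(\lambda)|\}$. *)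

theory Defs
  imports Complex_Main "Jordan_Normal_Form.Spectral_Radius"
begin

text \<open>
  The parameters are functions on the naturals, of which only the values at
  \<open>1, \<dots>, k\<close> are used. The operator is indexed from 1, so that its entries at
  row or column 0 carry no meaning; \<^term>\<open>mat\<close> and \<open>$$\<close> are indexed from 0.
\<close>

definition periodic_ext :: "nat \<Rightarrow> (nat \<Rightarrow> complex) \<Rightarrow> nat \<Rightarrow> complex" where
  "periodic_ext k a n = a (Suc ((n - 1) mod k))"

definition toeplitz_op ::
  "nat \<Rightarrow> (nat \<Rightarrow> complex) \<Rightarrow> (nat \<Rightarrow> complex) \<Rightarrow> (nat \<Rightarrow> complex) \<Rightarrow> nat \<Rightarrow> nat \<Rightarrow> complex" where
  "toeplitz_op k a b c m n =
     (if m = n then periodic_ext k a n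
      else if n = m + 1 then periodic_ext k b m
      else if m = n + 1 then periodic_ext k c n
      else 0)"

definition block_zero ::
  "nat \<Rightarrow> (nat \<Rightarrow> complex) \<Rightarrow> (nat \<Rightarrow> complex) \<Rightarrow> (nat \<Rightarrow> complex) \<Rightarrow> complex mat" where
  "block_zero k a b c = mat k k (\<lambda>(i, j). toeplitz_op k a b c (i + 1) (j + 1))"

definition block_minus_one :: "nat \<Rightarrow> (nat \<Rightarrow> complex) \<Rightarrow> complex mat" where
  "block_minus_one k b = mat k k (\<lambda>(i, j). if i + 1 = k \<and> j + 1 = 1 then b k else 0)"

definition block_one :: "nat \<Rightarrow> (nat \<Rightarrow> complex) \<Rightarrow> complex mat" where
  "block_one k c = mat k k (\<lambda>(i, j). if i + 1 = 1 \<and> j + 1 = k then c k else 0)"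

definition toeplitz_symbol ::
  "nat \<Rightarrow> (nat \<Rightarrow> complex) \<Rightarrow> (nat \<Rightarrow> complex) \<Rightarrow> (nat \<Rightarrow> complex) \<Rightarrow> complex \<Rightarrow> complex mat" where
  "toeplitz_symbol k a b c z =
     inverse z \<cdot>\<^sub>m block_minus_one k b + block_zero k a b c + z \<cdot>\<^sub>m block_one k c"

text \<open>
  The symbol is defined only away from 0, so \<open>z det (f z - \<lambda> Id)\<close> determines a
  polynomial through its values at \<open>z \<noteq> 0\<close>.
\<close>

definition is_symbol_poly ::
  "nat \<Rightarrow> (complex \<Rightarrow> complex mat) \<Rightarrow> complex \<Rightarrow> complex poly \<Rightarrow> bool" where
  "is_symbol_poly k f l p \<longleftrightarrow> (\<forall>z. z \<noteq> 0 \<longrightarrow> poly p z = z * det (f z - l \<cdot>\<^sub>m 1\<^sub>m k))"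

lemma is_symbol_poly_unique:
  assumes "is_symbol_poly k f l p" "is_symbol_poly k f l q"
  shows "p = q"
proof -
  have "UNIV - {0} \<subseteq> {z. poly (p - q) z = 0}"
    using assms by (auto simp: is_symbol_poly_def)
  moreover have "infinite (UNIV - {0 :: complex})"
    by (simp add: infinite_UNIV_char_0)
  ultimately have "infinite {z. poly (p - q) z = 0}"
    by (rule infinite_super)
  then show ?thesis
    using poly_roots_finite[of "p - q"] by auto
qed

text \<open>
  \<^term>\<open>proots p\<close> is the multiset of roots with multiplicity, and \<^term>\<open>proots 0\<close> is
  empty; hence \<open>proots p = {#z1, z2#}\<close> includes that \<open>p\<close> is exactly quadratic, and allows
  a double root \<open>z1 = z2\<close>.
\<close>

definition Gamma_set :: "nat \<Rightarrow> (complex \<Rightarrow> complex mat) \<Rightarrow> complex set" where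
  "Gamma_set k f =
     {l. \<exists>p z1 z2. is_symbol_poly k f l p \<and> proots p = {#z1, z2#} \<and> cmod z1 = cmod z2}"

end

theory Submission
  imports Defs
begin

text \<open>
  The symbol minus \<open>\<lambda> Id\<close> is a \<open>z\<close>-independent tridiagonal matrix with \<open>c\<^sub>k z\<close> and \<open>b\<^sub>k / z\<close> added
  in two opposite corners. Its determinant is affine in each of the two corner entries, and their product
  does not depend on \<open>z\<close>, so only the two corner cofactors matter. These are determinants of triangular
  matrices, and hence \<open>z det (f z - \<lambda> Id) = (-1)\<^sup>k\<^sup>-\<^sup>1 (C z\<^sup>2 + B) + g(\<lambda>) z\<close> with \<open>B\<close> and \<open>C\<close> the products
  of the \<open>b\<^sub>i\<close> and the \<open>c\<^sub>i\<close>. The roots satisfy \<open>\<bar>z\<^sub>1 z\<^sub>2\<bar> = \<bar>B / C\<bar> = r\<^sup>2\<close>, so they have equal moduli iff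
  one of them lies on the circle of radius \<open>r\<close>, that is, iff \<open>\<lambda>\<close> is an eigenvalue of \<open>f z\<close> for some \<open>z\<close>
  on this circle.
\<close>

definition entry_mat :: "nat \<Rightarrow> nat \<Rightarrow> nat \<Rightarrow> 'a :: zero \<Rightarrow> 'a mat" where
  "entry_mat n i j x = mat n n (\<lambda>(p, q). if p = i \<and> q = j then x else 0)"

lemma entry_mat_carrier [simp]: "entry_mat n i j x \<in> carrier_mat n n"
  and dim_entry_mat [simp]: "dim_row (entry_mat n i j x) = n" "dim_col (entry_mat n i j x) = n"
  by (simp_all add: entry_mat_def)

lemma index_entry_mat [simp]:
  "p < n \<Longrightarrow> q < n \<Longrightarrow> entry_mat n i j x $$ (p, q) = (if p = i \<and> q = j then x else 0)"
  by (simp add: entry_mat_def)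

text \<open>Laplace expansion along row \<open>i\<close>: only that row changes, and the cofactors
  of its entries delete it.\<close>

lemma det_add_entry_mat:
  fixes A :: "'a :: comm_ring_1 mat"
  assumes A: "A \<in> carrier_mat n n" and i: "i < n" and j: "j < n"
  shows "det (A + entry_mat n i j x) = det A + x * cofactor A i j"
proof -
  let ?B = "A + entry_mat n i j x"
  have cof: "cofactor ?B i q = cofactor A i q" if "q < n" for q
    unfolding cofactor_def
    by (intro arg_cong[where f = "\<lambda>M. _ * det M"] eq_matI) (use A i in \<open>auto simp: mat_delete_def\<close>)
  have "det ?B = (\<Sum>q<n. ?B $$ (i, q) * cofactor ?B i q)"
    using A i by (intro laplace_expansion_row) auto
  also have "\<dots> = (\<Sum>q<n. A $$ (i, q) * cofactor A i q + (if q = j then x * cofactor A i j else 0))"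
    using A i by (intro sum.cong) (auto simp: cof algebra_simps)
  also have "\<dots> = det A + x * cofactor A i j"
    using j by (simp add: sum.distrib laplace_expansion_row[OF A i])
  finally show ?thesis .
qed

text \<open>The constant \<open>w\<close> stays implicit: in the application \<open>u * v\<close> is
  independent of z, so the mixed term only enters the middle coefficient of the quadratic.\<close>

lemma det_add_corners:
  fixes A :: "'a :: comm_ring_1 mat"
  assumes A: "A \<in> carrier_mat (Suc n) (Suc n)"
  obtains w where "\<And>u v. det (A + entry_mat (Suc n) 0 n u + entry_mat (Suc n) n 0 v) =
    det A + u * cofactor A 0 n + v * cofactor A n 0 + u * v * w"
proof -
  have "\<exists>w. \<forall>v. cofactor (A + entry_mat (Suc n) n 0 v) 0 n = cofactor A 0 n + v * w"
  proof (cases n)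
    \<comment> \<open>Both corners are the single entry of a 1 by 1 matrix, so there is no mixed
      term.\<close>
    case 0
    then show ?thesis
      using A by (intro exI[of _ 0]) (simp add: cofactor_def mat_delete_def)
  next
    case (Suc m)
    have "cofactor (A + entry_mat (Suc n) n 0 v) 0 n =
        cofactor A 0 n + v * ((-1) ^ n * cofactor (mat_delete A 0 n) m 0)" for v
    proof -
      \<comment> \<open>Deleting row 0 shifts the lower left corner from row
        \<open>n = Suc m\<close> to row \<open>m\<close>.\<close>
      have "mat_delete (A + entry_mat (Suc n) n 0 v) 0 n = mat_delete A 0 n + entry_mat n m 0 v"
        using A Suc by (intro eq_matI) (auto simp: mat_delete_def)
      then show ?thesis
        using det_add_entry_mat[of "mat_delete A 0 n" n m 0 v] mat_delete_carrier[OF A, of 0 n] Suc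
        by (simp add: cofactor_def algebra_simps)
    qed
    then show ?thesis by blast
  qed
  then obtain w where w: "\<And>v. cofactor (A + entry_mat (Suc n) n 0 v) 0 n = cofactor A 0 n + v * w"
    by blast
  have "det (A + entry_mat (Suc n) 0 n u + entry_mat (Suc n) n 0 v) =
      det A + u * cofactor A 0 n + v * cofactor A n 0 + u * v * w" for u v
  proof -
    have "A + entry_mat (Suc n) 0 n u + entry_mat (Suc n) n 0 v =
        A + entry_mat (Suc n) n 0 v + entry_mat (Suc n) 0 n u"
      using A by (intro eq_matI) (auto simp: algebra_simps)
    then have "det (A + entry_mat (Suc n) 0 n u + entry_mat (Suc n) n 0 v) =
        det (A + entry_mat (Suc n) n 0 v) + u * cofactor (A + entry_mat (Suc n) n 0 v) 0 n"
      using A by (simp only:) (rule det_add_entry_mat, auto)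
    also have "\<dots> = det A + u * cofactor A 0 n + v * cofactor A n 0 + u * v * w"
      using A by (simp add: w det_add_entry_mat algebra_simps)
    finally show ?thesis .
  qed
  then show ?thesis by (rule that)
qed

text \<open>Deleting the first row and the last column moves the subdiagonal onto the diagonal and
  leaves an upper triangular matrix.\<close>

lemma cofactor_upper_Hessenberg:
  fixes A :: "'a :: comm_ring_1 mat"
  assumes A: "A \<in> carrier_mat (Suc n) (Suc n)"
    and zero: "\<And>i j. Suc j < i \<Longrightarrow> i \<le> n \<Longrightarrow> A $$ (i, j) = 0"
  shows "cofactor A 0 n = (-1) ^ n * (\<Prod>i<n. A $$ (Suc i, i))"
proof -
  have "det (mat_delete A 0 n) = prod_list (diag_mat (mat_delete A 0 n))"
    using A zero mat_delete_carrier[OF A, of 0 n]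
    by (intro det_upper_triangular) (auto simp: mat_delete_def)
  also have "\<dots> = (\<Prod>i<n. A $$ (Suc i, i))"
    using A by (simp add: diag_mat_def mat_delete_def prod.list_conv_set_nth atLeast0LessThan)
  finally show ?thesis by (simp add: cofactor_def)
qed

lemma cofactor_lower_Hessenberg:
  fixes A :: "'a :: comm_ring_1 mat"
  assumes A: "A \<in> carrier_mat (Suc n) (Suc n)"
    and zero: "\<And>i j. Suc i < j \<Longrightarrow> j \<le> n \<Longrightarrow> A $$ (i, j) = 0"
  shows "cofactor A n 0 = (-1) ^ n * (\<Prod>i<n. A $$ (i, Suc i))"
proof -
  have "det (mat_delete A n 0) = prod_list (diag_mat (mat_delete A n 0))"
    using A zero mat_delete_carrier[OF A, of n 0]
    by (intro det_lower_triangular[where n = n]) (auto simp: mat_delete_def)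
  also have "\<dots> = (\<Prod>i<n. A $$ (i, Suc i))"
    using A by (simp add: diag_mat_def mat_delete_def prod.list_conv_set_nth atLeast0LessThan)
  finally show ?thesis by (simp add: cofactor_def)
qed

lemma toeplitz_symbol_carrier [simp]:
  "toeplitz_symbol k a b c z \<in> carrier_mat k k"
  by (auto simp: toeplitz_symbol_def block_zero_def block_minus_one_def block_one_def)

lemma toeplitz_symbol_poly:
  assumes "k \<ge> 1"
  obtains g where "is_symbol_poly k (toeplitz_symbol k a b c) l
    [:(-1) ^ (k - 1) * (\<Prod>i=1..k. b i), g, (-1) ^ (k - 1) * (\<Prod>i=1..k. c i):]"
proof -
  obtain n where k: "k = Suc n"
    using assms by (cases k) auto
  define M where "M = block_zero k a b c - l \<cdot>\<^sub>m 1\<^sub>m k"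
  have M: "M \<in> carrier_mat (Suc n) (Suc n)"
    by (auto simp: M_def block_zero_def k)
  \<comment> \<open>\<open>M\<close> contains only the first \<open>n = k - 1\<close> off-diagonal
    parameters on each side; the missing factors \<open>c k\<close> and \<open>b k\<close> are
    supplied by the corner entries.\<close>
  have cof_c: "cofactor M 0 n = (-1) ^ n * (\<Prod>i<n. c (Suc i))"
    by (subst cofactor_upper_Hessenberg[OF M])
      (auto simp: M_def block_zero_def toeplitz_op_def periodic_ext_def k)
  have cof_b: "cofactor M n 0 = (-1) ^ n * (\<Prod>i<n. b (Suc i))"
    by (subst cofactor_lower_Hessenberg[OF M])
      (auto simp: M_def block_zero_def toeplitz_op_def periodic_ext_def k)
  have prod: "prod d {Suc 0..Suc n} = (\<Prod>i<n. d (Suc i)) * d (Suc n)" for d :: "nat \<Rightarrow> complex"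
    using prod.atLeast1_atMost_eq[of d "Suc n"] by (simp del: prod.cl_ivl_Suc)
  obtain w where w: "\<And>u v. det (M + entry_mat (Suc n) 0 n u + entry_mat (Suc n) n 0 v) =
      det M + u * cofactor M 0 n + v * cofactor M n 0 + u * v * w"
    using det_add_corners[OF M] by blast
  have "is_symbol_poly k (toeplitz_symbol k a b c) l
      [:(-1) ^ (k - 1) * (\<Prod>i=1..k. b i), det M + b k * c k * w, (-1) ^ (k - 1) * (\<Prod>i=1..k. c i):]"
    unfolding is_symbol_poly_def
  proof (intro allI impI)
    fix z :: complex
    assume z: "z \<noteq> 0"
    have "toeplitz_symbol k a b c z - l \<cdot>\<^sub>m 1\<^sub>m k =
        M + entry_mat (Suc n) 0 n (z * c k) + entry_mat (Suc n) n 0 (inverse z * b k)"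
      by (intro eq_matI)
        (auto simp: M_def toeplitz_symbol_def block_zero_def block_minus_one_def block_one_def k)
    then show "poly [:(-1) ^ (k - 1) * (\<Prod>i=1..k. b i), det M + b k * c k * w,
          (-1) ^ (k - 1) * (\<Prod>i=1..k. c i):] z =
        z * det (toeplitz_symbol k a b c z - l \<cdot>\<^sub>m 1\<^sub>m k)"
      using z by (simp add: w cof_b cof_c prod k field_simps del: prod.cl_ivl_Suc)
  qed
  then show ?thesis by (rule that)
qed

text \<open>The extra factor \<open>z\<close> in the symbol polynomial is nonzero, so it adds no
  root here.\<close>

lemma in_spectrum_iff_poly_root:
  assumes "is_symbol_poly k f l p" "f z \<in> carrier_mat k k" "z \<noteq> 0"
  shows "l \<in> spectrum (f z) \<longleftrightarrow> poly p z = 0"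
proof -
  have "char_matrix (f z) l = f z - l \<cdot>\<^sub>m 1\<^sub>m k"
    using assms(2) by (intro eq_matI) (auto simp: char_matrix_def)
  then show ?thesis
    using assms by (simp add: spectrum_def eigenvalue_det is_symbol_poly_def)
qed

lemma equal_cmod_roots_iff:
  fixes B g C :: complex
  assumes C: "C \<noteq> 0" and r: "r > 0" "r\<^sup>2 = cmod (B / C)"
  shows "(\<exists>z1 z2. proots [:B, g, C:] = {#z1, z2#} \<and> cmod z1 = cmod z2) \<longleftrightarrow>
    (\<exists>z. cmod z = r \<and> poly [:B, g, C:] z = 0)"
proof -
  let ?p = "[:B, g, C:]"
  obtain zs where zs: "mset zs = proots ?p"
    using ex_mset by blast
  have "length zs = 2"
    using C size_proots_complex[of ?p] by (simp flip: zs)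
  then obtain z1 z2 where "zs = [z1, z2]"
    by (auto simp: numeral_2_eq_2 length_Suc_conv)
  with zs have roots: "proots ?p = {#z1, z2#}"
    by simp
  have p: "?p = Polynomial.smult C ([:- z1, 1:] * [:- z2, 1:])"
    using complex_poly_decompose_multiset[of ?p] C roots by simp
  \<comment> \<open>Compare constant coefficients.\<close>
  then have "B = C * (z1 * z2)" by simp
  then have prod: "cmod z1 * cmod z2 = r * r"
    using C r(2) by (simp add: norm_mult norm_divide power2_eq_square)
  have "cmod z1 = cmod z2 \<longleftrightarrow> cmod z1 = r \<or> cmod z2 = r"
  proof
    assume "cmod z1 = cmod z2"
    then have "(cmod z1)\<^sup>2 = r\<^sup>2"
      using prod by (simp add: power2_eq_square)
    then show "cmod z1 = r \<or> cmod z2 = r"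
      using r(1) by (simp add: power2_eq_iff_nonneg)
  \<comment> \<open>If one root has modulus \<open>r\<close>, cancelling \<open>r > 0\<close> in
    \<open>prod\<close> gives the other the same modulus.\<close>
  qed (use prod r(1) in auto)
  moreover have "poly ?p z = 0 \<longleftrightarrow> z = z1 \<or> z = z2" for z
    unfolding p poly_smult poly_mult using C by simp
  \<comment> \<open>The multiset fixes the pair of roots only up to order, and equality of moduli is
    symmetric.\<close>
  moreover have "(\<exists>x y. proots ?p = {#x, y#} \<and> cmod x = cmod y) \<longleftrightarrow> cmod z1 = cmod z2"
    unfolding roots by (auto simp: add_eq_conv_ex)
  ultimately show ?thesis by metis
qed

lemma circle_eq_image_exp:
  assumes "r \<ge> 0"
  shows "{z. cmod z = r} = (\<lambda>\<alpha>. complex_of_real r * exp (\<i> * complex_of_real \<alpha>)) ` {-pi..pi}"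
proof (intro equalityI subsetI)
  fix z :: complex
  assume "z \<in> {z. cmod z = r}"
  then have "z = complex_of_real r * exp (\<i> * complex_of_real (Arg z))"
    using rcis_cmod_Arg[of z] by (simp add: rcis_def cis_conv_exp)
  moreover have "Arg z \<in> {-pi..pi}"
    using Arg_bounded[of z] by simp
  ultimately show "z \<in> (\<lambda>\<alpha>. complex_of_real r * exp (\<i> * complex_of_real \<alpha>)) ` {-pi..pi}"
    by blast
qed (use assms in \<open>auto simp: norm_mult simp flip: cis_conv_exp\<close>)

theorem lemma2p1:
  fixes k :: nat and a b c :: "nat \<Rightarrow> complex" and r :: real
  assumes "k \<ge> 1"
    and "\<And>i. i \<in> {1..k} \<Longrightarrow> b i \<noteq> 0"
    and "\<And>i. i \<in> {1..k} \<Longrightarrow> c i \<noteq> 0"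
    and "r = sqrt (\<Prod>i=1..k. cmod (b i / c i))"
  shows "Gamma_set k (toeplitz_symbol k a b c) =
    (\<Union>\<alpha>\<in>{-pi..pi}. spectrum (toeplitz_symbol k a b c (complex_of_real r * exp (\<i> * complex_of_real \<alpha>))))"
proof -
  let ?f = "toeplitz_symbol k a b c"
  define B where "B = (-1) ^ (k - 1) * (\<Prod>i=1..k. b i)"
  define C where "C = (-1) ^ (k - 1) * (\<Prod>i=1..k. c i)"
  have C: "C \<noteq> 0"
    using assms(3) by (auto simp: C_def)
  have pos: "(\<Prod>i=1..k. cmod (b i / c i)) > 0"
    using assms(2,3) by (intro prod_pos) auto
  have r: "r > 0"
    using pos by (simp add: assms(4))
  \<comment> \<open>The signs in \<open>B\<close> and \<open>C\<close> have modulus 1.\<close>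
  have r2: "r\<^sup>2 = cmod (B / C)"
    using pos by (simp add: assms(4) B_def C_def norm_mult norm_divide norm_power prod_norm prod_dividef)
  have "l \<in> Gamma_set k ?f \<longleftrightarrow> (\<exists>z. cmod z = r \<and> l \<in> spectrum (?f z))" for l
  proof -
    obtain g where g: "is_symbol_poly k ?f l [:B, g, C:]"
      using toeplitz_symbol_poly[OF assms(1), of a b c l] unfolding B_def C_def by blast
    \<comment> \<open>Uniqueness of the symbol polynomial replaces the existentially quantified
      \<open>p\<close> by the explicit quadratic.\<close>
    have "l \<in> Gamma_set k ?f \<longleftrightarrow>
        (\<exists>z1 z2. proots [:B, g, C:] = {#z1, z2#} \<and> cmod z1 = cmod z2)"
      using g is_symbol_poly_unique[OF _ g] unfolding Gamma_set_def by blast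
    also have "\<dots> \<longleftrightarrow> (\<exists>z. cmod z = r \<and> poly [:B, g, C:] z = 0)"
      by (rule equal_cmod_roots_iff[OF C r r2])
    also have "\<dots> \<longleftrightarrow> (\<exists>z. cmod z = r \<and> l \<in> spectrum (?f z))"
    proof -
      have "l \<in> spectrum (?f z) \<longleftrightarrow> poly [:B, g, C:] z = 0" if "cmod z = r" for z
        using that r by (intro in_spectrum_iff_poly_root[OF g]) auto
      then show ?thesis by blast
    qed
    finally show ?thesis .
  qed
  then have "Gamma_set k ?f = (\<Union>z\<in>{z. cmod z = r}. spectrum (?f z))"
    by blast
  then show ?thesis
    using r by (simp add: circle_eq_image_exp)
qed

end
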